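(* Let $k$ be a field, $S = k[x_1,\ldots,x_n]$ with $n\ge1$, $I \subset S$ a proper homogeneous ideal, and $d=\dim S/I$. Assume that $r(I)<\infty$. Then $r(I) = \max_{a\in F_d}|a|$.
   Context: $\operatorname{in}(I)$ denotes the initial ideal of $I$ with respect to the (degree) reverse lexicographic order with $x_1>\cdots>x_n$. Put $S_d = k[x_1,\ldots,x_{n-d}]$ and let $J_d\subset S_d$ be the ideal obtained from $\operatorname{in}(I)$ by the evaluation $x_{n-d+1}=\cdots=x_n=0$; i.e. $J_d$ is generated by the monomial generators of $\operatorname{in}(I)$ not divisible by any of $x_{n-d+1},\ldots,x_n$. Define $r(I) := \sup\{r \mid (S_d/J_d)_r\neq0\}$. Let $\mathcal B$ be the finite set of monomials minimally generating $\operatorname{in}(I)$, and $E_d := \{v\in\mathbb N^{n-d} \mid x^v\in\mathcal B\}$, where $x^v = x_1^{\varepsilon_1}\cdots x_s^{\varepsilon_s}$ for $v=(\varepsilon_1,\ldots,\varepsilon_s)$; here $0\in\mathbb N$. For vectors, $a\ge b$ means coordinatewise inequality. $F_d$ is the set of all vectors of the form $a=\max(v_1,\ldots,v_{n-d})-(1,\ldots,1)$ such that $a\not\ge v$ for every $v\in E_d$, where $v_1,\ldots,v_{n-d}$ is a family of elements of $E_d$ such that for each $j=1,\ldots,n-d$ the $j$th coordinate of $v_j$ is greater than the $j$th coordinate of $v_h$ for all $h\ne j$, and $\max$ is the coordinatewise maximum. For $a=(\alpha_1,\ldots,\alpha_{n-d})$, $|a| := \alpha_1+\cdots+\alpha_{n-d}$.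 (In the degenerate case $d=n$, i.e. $I=0$, $F_n$ consists of the single empty vector, with $|a|=0$.) *)

theory Defs
  imports "HOL-Algebra.QuotRing" "HOL-Library.Poly_Mapping" "HOL-Library.Extended_Nat"
begin

text \<open>Vectors in \<open>\<nat>\<^sup>m\<close> (equivalently, exponents of monomials in \<open>x\<^sub>1, \<dots>, x\<^sub>m\<close>) are finitely
  supported functions on \<open>nat\<close> with support in \<open>{1..m}\<close>; thus \<open>\<nat>\<^sup>m\<close> is a subset of \<open>\<nat>\<^sup>n\<close>
  for \<open>m \<le> n\<close>, just as \<open>k[x\<^sub>1, \<dots>, x\<^sub>m]\<close> is a subring of \<open>k[x\<^sub>1, \<dots>, x\<^sub>n]\<close>.\<close>

type_synonym expo = "nat \<Rightarrow>\<^sub>0 nat"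

definition expos :: "nat \<Rightarrow> expo set" where
  "expos m = {v. Poly_Mapping.keys v \<subseteq> {1..m}}"

definition expo_deg :: "expo \<Rightarrow> nat" where
  "expo_deg v = (\<Sum>i\<in>Poly_Mapping.keys v. Poly_Mapping.lookup v i)"

type_synonym 'k mpol = "expo \<Rightarrow>\<^sub>0 'k"

definition poly_ring :: "nat \<Rightarrow> ('k::field) mpol ring" where
  "poly_ring m = \<lparr>carrier = {p. Poly_Mapping.keys p \<subseteq> expos m},
     mult = (*), one = 1, zero = 0, add = (+)\<rparr>"

definition xpow :: "expo \<Rightarrow> ('k::field) mpol" where
  "xpow v = Poly_Mapping.single v 1"

definition homogeneous :: "nat \<Rightarrow> ('k::field) mpol \<Rightarrow> bool" where
  "homogeneous r p \<longleftrightarrow> (\<forall>t\<in>Poly_Mapping.keys p. expo_deg t = r)"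

definition homogeneous_ideal :: "nat \<Rightarrow> ('k::field) mpol set \<Rightarrow> bool" where
  "homogeneous_ideal m I \<longleftrightarrow> ideal I (poly_ring m) \<and>
     (\<exists>G\<subseteq>carrier (poly_ring m). (\<forall>g\<in>G. \<exists>r. homogeneous r g) \<and> I = genideal (poly_ring m) G)"

definition krull_dim :: "('a, 'b) ring_scheme \<Rightarrow> enat" where
  "krull_dim R = Sup {enat l | l. \<exists>P. (\<forall>i\<le>l. primeideal (P i) R) \<and> (\<forall>i<l. P i \<subset> P (Suc i))}"

text \<open>The strict degree reverse lexicographic order with \<open>x\<^sub>1 > x\<^sub>2 > \<dots>\<close>.\<close>

definition drl_less :: "expo \<Rightarrow> expo \<Rightarrow> bool" where
  "drl_less s t \<longleftrightarrow> expo_deg s < expo_deg t \<or>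
     (expo_deg s = expo_deg t \<and>
      (\<exists>i. Poly_Mapping.lookup t i < Poly_Mapping.lookup s i \<and>
           (\<forall>j>i. Poly_Mapping.lookup t j = Poly_Mapping.lookup s j)))"

definition is_lead_expo :: "('k::field) mpol \<Rightarrow> expo \<Rightarrow> bool" where
  "is_lead_expo p t \<longleftrightarrow> t \<in> Poly_Mapping.keys p \<and>
     (\<forall>s\<in>Poly_Mapping.keys p. s \<noteq> t \<longrightarrow> drl_less s t)"

definition initial_ideal :: "nat \<Rightarrow> ('k::field) mpol set \<Rightarrow> 'k mpol set" where
  "initial_ideal n I = genideal (poly_ring n) {xpow t | t. \<exists>f\<in>I. is_lead_expo f t}"

text \<open>The evaluation \<open>x\<^sub>i = 0\<close> for all \<open>i > m\<close>.\<close>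

definition eval_tail_zero :: "nat \<Rightarrow> ('k::field) mpol \<Rightarrow> 'k mpol" where
  "eval_tail_zero m p =
     (\<Sum>t\<in>Poly_Mapping.keys p. Poly_Mapping.single 0 (Poly_Mapping.lookup p t) *
        (\<Prod>i\<in>Poly_Mapping.keys t.
           (if i \<le> m then xpow (Poly_Mapping.single i 1) else 0) ^ Poly_Mapping.lookup t i))"

text \<open>The ideal \<open>J\<^sub>d\<close> of \<open>S\<^sub>d = k[x\<^sub>1, \<dots>, x\<^bsub>n-d\<^esub>]\<close>.\<close>

definition J_ideal :: "nat \<Rightarrow> nat \<Rightarrow> ('k::field) mpol set \<Rightarrow> 'k mpol set" where
  "J_ideal n d I = eval_tail_zero (n - d) ` initial_ideal n I"

text \<open>The degree-\<open>r\<close> component \<open>(S/J)\<^sub>r\<close>, as the image of \<open>S\<^sub>r\<close> in the quotient ring.\<close>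

definition quot_component :: "nat \<Rightarrow> ('k::field) mpol set \<Rightarrow> nat \<Rightarrow> 'k mpol set set" where
  "quot_component m J r =
     {J +>\<^bsub>poly_ring m\<^esub> f | f. f \<in> carrier (poly_ring m) \<and> homogeneous r f}"

definition r_inv :: "nat \<Rightarrow> nat \<Rightarrow> ('k::field) mpol set \<Rightarrow> enat" where
  "r_inv n d I = Sup {enat r | r. quot_component (n - d) (J_ideal n d I) r
     \<noteq> {\<zero>\<^bsub>poly_ring (n - d) Quot J_ideal n d I\<^esub>}}"

text \<open>For a monomial ideal \<open>J\<close> there is exactly one such set \<open>B\<close>, and it is finite.\<close>

definition minimal_monomial_generators :: "nat \<Rightarrow> ('k::field) mpol set \<Rightarrow> 'k mpol set \<Rightarrow> bool" where
  "minimal_monomial_generators n J B \<longleftrightarrow>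
     B \<subseteq> xpow ` expos n \<and> genideal (poly_ring n) B = J \<and>
     (\<forall>C. C \<subset> B \<longrightarrow> genideal (poly_ring n) C \<noteq> J)"

definition E_set :: "nat \<Rightarrow> ('k::field) mpol set \<Rightarrow> expo set" where
  "E_set m B = {v \<in> expos m. xpow v \<in> B}"

text \<open>\<open>F_set m (E_set m B)\<close> with \<open>m = n - d\<close> is \<open>F\<^sub>d\<close>. The equation \<open>a = max(v\<^sub>1, \<dots>, v\<^sub>m) - (1, \<dots>, 1)\<close>
  is written as \<open>a + (1, \<dots>, 1) = max(v\<^sub>1, \<dots>, v\<^sub>m)\<close> to avoid truncated subtraction; the
  maximum is never \<open>0\<close> in a coordinate as long as \<open>0 \<notin> E\<close>, i.e. for a proper ideal.
  For \<open>m = 0\<close> the family \<open>v\<close> is empty and \<open>F_set 0 {} = {0}\<close>.\<close>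

definition F_set :: "nat \<Rightarrow> expo set \<Rightarrow> expo set" where
  "F_set m E = {a \<in> expos m.
     (\<exists>v. (\<forall>j\<in>{1..m}. v j \<in> E) \<and>
          (\<forall>j\<in>{1..m}. \<forall>h\<in>{1..m}. h \<noteq> j \<longrightarrow>
              Poly_Mapping.lookup (v h) j < Poly_Mapping.lookup (v j) j) \<and>
          (\<forall>j\<in>{1..m}. Poly_Mapping.lookup a j + 1 =
              Max ((\<lambda>h. Poly_Mapping.lookup (v h) j) ` {1..m}))) \<and>
     (\<forall>w\<in>E. \<not> (\<forall>j\<in>{1..m}. Poly_Mapping.lookup w j \<le> Poly_Mapping.lookup a j))}"

lemma expos_add: "s \<in> expos m \<Longrightarrow> t \<in> expos m \<Longrightarrow> s + t \<in> expos m"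
  using Poly_Mapping.keys_add[of s t] by (auto simp: expos_def)

lemma poly_ring_cring: "cring (poly_ring m :: ('k::field) mpol ring)"
proof (rule cringI)
  show "abelian_group (poly_ring m :: 'k mpol ring)"
  proof (rule abelian_groupI)
    fix x :: "'k mpol" assume x: "x \<in> carrier (poly_ring m)"
    show "\<exists>y\<in>carrier (poly_ring m). y \<oplus>\<^bsub>poly_ring m\<^esub> x = \<zero>\<^bsub>poly_ring m\<^esub>"
      by (rule bexI[of _ "- x"]) (use x in \<open>auto simp: poly_ring_def\<close>)
  qed (use Poly_Mapping.keys_add in \<open>fastforce simp: poly_ring_def algebra_simps\<close>)+
  show "comm_monoid (poly_ring m :: 'k mpol ring)"
  proof (rule comm_monoidI)
    fix x y :: "'k mpol"
    assume "x \<in> carrier (poly_ring m)" "y \<in> carrier (poly_ring m)"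
    then show "x \<otimes>\<^bsub>poly_ring m\<^esub> y \<in> carrier (poly_ring m)"
      using keys_mult[of x y] expos_add[of _ m] by (fastforce simp: poly_ring_def)
  qed (auto simp: poly_ring_def expos_def algebra_simps)
qed (auto simp: poly_ring_def algebra_simps)

end

theory Submission
  imports Defs
begin

text \<open>The ideal \<open>J\<^sub>d\<close> is the monomial ideal generated by the \<open>x\<^sup>v\<close> with \<open>v \<in> E\<^sub>d\<close>, so \<open>r(I)\<close> is the
  supremum of the degrees of the standard exponents, those not above any \<open>v \<in> E\<^sub>d\<close>. The elements of
  \<open>F\<^sub>d\<close> are exactly the standard \<open>a\<close> such that no \<open>a + e\<^sub>j\<close> is standard: a generator \<open>v\<^sub>j \<le> a + e\<^sub>j\<close>
  with \<open>v\<^sub>j \<not>\<le> a\<close> has \<open>j\<close>th coordinate \<open>a\<^sub>j + 1\<close> and all its other coordinates at most those of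
  \<open>a\<close>. If \<open>r(I) < \<infinity>\<close>, then a standard exponent of maximal degree exists and lies in \<open>F\<^sub>d\<close>.\<close>

text \<open>For \<open>A\<close> inside \<open>expos m\<close> this is the up-set of
  \<open>A\<close> in N^m, that is, the exponents of all monomials in the ideal generated by the
  \<open>xpow w\<close>. The index \<open>m\<close> restricts the cofactor \<open>u\<close>, so
  passing to fewer variables changes the up-set.\<close>

definition multiples :: "nat \<Rightarrow> expo set \<Rightarrow> expo set" where
  "multiples m A = {w + u | w u. w \<in> A \<and> u \<in> expos m}"

text \<open>This is the k-linear span of the monomials with exponent in \<open>T\<close>; the
  support condition turns membership in a monomial ideal into a check on exponents.\<close>

definition monomial_span :: "expo set \<Rightarrow> ('k::field) mpol set" where
  "monomial_span T = {p. Poly_Mapping.keys p \<subseteq> T}"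

section \<open>Exponent vectors, degree and divisibility\<close>

lemma carrier_poly_ring: "carrier (poly_ring m) = {p. Poly_Mapping.keys p \<subseteq> expos m}"
  by (simp add: poly_ring_def)

lemma zero_expos [simp]: "0 \<in> expos m"
  by (simp add: expos_def)

lemma single_expos: "j \<in> {1..m} \<Longrightarrow> Poly_Mapping.single j c \<in> expos m"
  by (simp add: expos_def)

lemma lookup_expos_eq_0: "v \<in> expos m \<Longrightarrow> j \<notin> {1..m} \<Longrightarrow> Poly_Mapping.lookup v j = 0"
  by (auto simp: expos_def in_keys_iff)

lemma expos_iff: "v \<in> expos m \<longleftrightarrow> (\<forall>j. j \<notin> {1..m} \<longrightarrow> Poly_Mapping.lookup v j = 0)"
  unfolding expos_def by (auto simp: in_keys_iff)

lemma expos_mono: "l \<le> m \<Longrightarrow> expos l \<subseteq> expos m"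
  by (auto simp: expos_def)

text \<open>Natural exponents cannot cancel. Hence a multiple that avoids the last variables comes
  from a generator and a cofactor that avoid them too.\<close>

lemma add_mem_expos_iff: "s + t \<in> expos m \<longleftrightarrow> s \<in> expos m \<and> t \<in> expos m"
  by (auto simp: expos_iff lookup_add)

lemma expo_deg_eq_sum:
  assumes "v \<in> expos m"
  shows "expo_deg v = (\<Sum>i=1..m. Poly_Mapping.lookup v i)"
  unfolding expo_deg_def
  by (rule sum.mono_neutral_left) (use assms in \<open>auto simp: expos_def in_keys_iff\<close>)

lemma expo_deg_add:
  assumes "s \<in> expos m" "t \<in> expos m"
  shows "expo_deg (s + t) = expo_deg s + expo_deg t"
  using assms by (simp add: expo_deg_eq_sum[of _ m] expos_add lookup_add sum.distrib)

lemma expo_deg_single [simp]: "expo_deg (Poly_Mapping.single j c) = c"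
  by (simp add: expo_deg_def)

text \<open>Each coordinate is at most the degree, which leaves finitely many coordinate functions.
  A degree bound thus makes the set of standard exponents finite.\<close>

lemma finite_expos_deg_le: "finite {v \<in> expos m. expo_deg v \<le> N}"
proof (rule finite_imageD)
  let ?F = "{f. \<forall>i. (i \<in> {1..m} \<longrightarrow> f i \<in> {..N}) \<and> (i \<notin> {1..m} \<longrightarrow> f i = (0::nat))}"
  have "Poly_Mapping.lookup v i \<le> N" if "v \<in> expos m" "expo_deg v \<le> N" "i \<in> {1..m}" for v i
    using member_le_sum[of i "{1..m}" "Poly_Mapping.lookup v"] that
    by (simp add: expo_deg_eq_sum[of v m])
  then have "Poly_Mapping.lookup ` {v \<in> expos m. expo_deg v \<le> N} \<subseteq> ?F"
    using lookup_expos_eq_0[of _ m] by (auto simp del: atLeastAtMost_iff)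
  moreover have "finite ?F"
    by (rule finite_set_of_finite_funs) auto
  ultimately show "finite (Poly_Mapping.lookup ` {v \<in> expos m. expo_deg v \<le> N})"
    by (rule finite_subset)
qed (simp add: inj_on_def)

lemma mem_multiples_iff:
  assumes "A \<subseteq> expos m" "a \<in> expos m"
  shows "a \<in> multiples m A \<longleftrightarrow>
    (\<exists>w\<in>A. \<forall>j\<in>{1..m}. Poly_Mapping.lookup w j \<le> Poly_Mapping.lookup a j)"
proof
  assume "\<exists>w\<in>A. \<forall>j\<in>{1..m}. Poly_Mapping.lookup w j \<le> Poly_Mapping.lookup a j"
  then obtain w where w: "w \<in> A" "\<forall>j\<in>{1..m}. Poly_Mapping.lookup w j \<le> Poly_Mapping.lookup a j"
    by blast
  \<comment> \<open>Outside \<open>{1..m}\<close> the vector \<open>w\<close> vanishes, so the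
    inequality holds at every index and the truncated difference \<open>a - w\<close> is a genuine
    cofactor.\<close>
  have le: "Poly_Mapping.lookup w j \<le> Poly_Mapping.lookup a j" for j
    using w assms(1) lookup_expos_eq_0[of w m j] by (cases "j \<in> {1..m}") auto
  have "a = w + (a - w)"
    by (rule poly_mapping_eqI) (simp add: lookup_add lookup_minus le)
  moreover have "a - w \<in> expos m"
    using assms(2) by (auto simp: expos_iff lookup_minus)
  ultimately show "a \<in> multiples m A"
    using w(1) unfolding multiples_def by blast
qed (force simp: multiples_def lookup_add)

lemma multiples_subset_expos: "A \<subseteq> expos m \<Longrightarrow> multiples m A \<subseteq> expos m"
  by (auto simp: multiples_def intro: expos_add)

lemma subset_multiples: "A \<subseteq> multiples m A"
  by (force simp: multiples_def)

lemma add_mem_multiples: "t \<in> multiples m A \<Longrightarrow> s \<in> expos m \<Longrightarrow> t + s \<in> multiples m A"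
  unfolding multiples_def using add.assoc expos_add by blast

lemma zero_mem_multiples_iff: "0 \<in> multiples m A \<longleftrightarrow> 0 \<in> A"
proof
  assume "0 \<in> multiples m A"
  then obtain w u where wu: "0 = w + u" "w \<in> A" unfolding multiples_def by blast
  have "Poly_Mapping.lookup w i = 0" for i
    using arg_cong[OF wu(1), of "\<lambda>p. Poly_Mapping.lookup p i"] by (simp add: lookup_add)
  then have "w = 0" by (intro poly_mapping_eqI) simp
  with wu show "0 \<in> A" by simp
qed (use subset_multiples in blast)

section \<open>Monomial ideals described by supports\<close>

lemma xpow_mem_monomial_span_iff [simp]: "(xpow t :: ('k::field) mpol) \<in> monomial_span T \<longleftrightarrow> t \<in> T"
  by (simp add: xpow_def monomial_span_def)

lemma xpow_carrier: "t \<in> expos m \<Longrightarrow> xpow t \<in> carrier (poly_ring m)"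
  by (simp add: xpow_def carrier_poly_ring)

lemma ideal_monomial_span:
  assumes "A \<subseteq> expos m"
  shows "ideal (monomial_span (multiples m A) :: ('k::field) mpol set) (poly_ring m)"
proof (rule idealI)
  let ?J = "monomial_span (multiples m A) :: 'k mpol set"
  interpret cring "poly_ring m :: 'k mpol ring" by (rule poly_ring_cring)
  have closed: "p * q \<in> ?J" if "p \<in> ?J" "q \<in> carrier (poly_ring m)" for p q :: "'k mpol"
    using that keys_mult[of p q] add_mem_multiples[of _ m A]
    by (fastforce simp: monomial_span_def carrier_poly_ring)
  show "ring (poly_ring m :: 'k mpol ring)" by (rule ring_axioms)
  show "subgroup ?J (add_monoid (poly_ring m))"
  proof (rule add.subgroupI)
    show "?J \<subseteq> carrier (poly_ring m)"
      using multiples_subset_expos[OF assms] by (auto simp: monomial_span_def carrier_poly_ring)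
    show "?J \<noteq> {}"
      by (auto simp: monomial_span_def intro!: exI[of _ 0])
    show "\<ominus>\<^bsub>poly_ring m\<^esub> p \<in> ?J" if "p \<in> ?J" for p
    proof -
      \<comment> \<open>The ring negative is an abstract inverse whose support is not directly
        visible; as a product of \<open>p\<close> with minus one it falls under
        \<open>closed\<close>.\<close>
      have "\<ominus>\<^bsub>poly_ring m\<^esub> p = \<ominus>\<^bsub>poly_ring m\<^esub> \<one>\<^bsub>poly_ring m\<^esub> \<otimes>\<^bsub>poly_ring m\<^esub> p"
        using that \<open>?J \<subseteq> carrier (poly_ring m)\<close> by (subst l_minus) auto
      also have "\<dots> = p \<otimes>\<^bsub>poly_ring m\<^esub> \<ominus>\<^bsub>poly_ring m\<^esub> \<one>\<^bsub>poly_ring m\<^esub>"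
        using that \<open>?J \<subseteq> carrier (poly_ring m)\<close> by (intro m_comm) auto
      also have "\<dots> = p * \<ominus>\<^bsub>poly_ring m\<^esub> \<one>\<^bsub>poly_ring m\<^esub>"
        by (simp add: poly_ring_def)
      finally show ?thesis
        using closed[OF that, of "\<ominus>\<^bsub>poly_ring m\<^esub> \<one>\<^bsub>poly_ring m\<^esub>"] by simp
    qed
    show "p \<oplus>\<^bsub>poly_ring m\<^esub> q \<in> ?J" if "p \<in> ?J" "q \<in> ?J" for p q
      using that Poly_Mapping.keys_add[of p q] by (auto simp: monomial_span_def poly_ring_def)
  qed
  show "x \<otimes>\<^bsub>poly_ring m\<^esub> p \<in> ?J" "p \<otimes>\<^bsub>poly_ring m\<^esub> x \<in> ?J"
    if "p \<in> ?J" "x \<in> carrier (poly_ring m)" for p x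
    using closed[OF that] by (simp_all add: poly_ring_def mult.commute)
qed

lemma poly_mapping_eq_sum_single:
  fixes p :: "'a \<Rightarrow>\<^sub>0 'b::comm_monoid_add"
  shows "p = (\<Sum>t\<in>Poly_Mapping.keys p. Poly_Mapping.single t (Poly_Mapping.lookup p t))"
  by (rule poly_mapping_eqI)
    (simp add: lookup_sum lookup_single when_def sum.delta not_in_keys_iff_lookup_eq_zero)

text \<open>The span is an ideal containing the generators, which gives one inclusion. Conversely,
  each term of a polynomial in the span is a generator times a term, and the polynomial is the
  finite sum of its terms.\<close>

lemma genideal_xpow:
  assumes "A \<subseteq> expos m"
  shows "genideal (poly_ring m) (xpow ` A :: ('k::field) mpol set) = monomial_span (multiples m A)"
    (is "?I = ?J")
proof
  interpret cring "poly_ring m :: 'k mpol ring" by (rule poly_ring_cring)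
  have gens: "(xpow ` A :: 'k mpol set) \<subseteq> carrier (poly_ring m)"
    using assms xpow_carrier by blast
  show "?I \<subseteq> ?J"
    by (rule genideal_minimal[OF ideal_monomial_span[OF assms]]) (use subset_multiples[of A m] in auto)
  interpret I: ideal ?I "poly_ring m" by (rule genideal_ideal[OF gens])
  have single: "Poly_Mapping.single t c \<in> ?I" if t: "t \<in> multiples m A" for t and c :: 'k
  proof -
    obtain w u where wu: "t = w + u" "w \<in> A" "u \<in> expos m"
      using t unfolding multiples_def by blast
    have "xpow w \<otimes>\<^bsub>poly_ring m\<^esub> Poly_Mapping.single u c \<in> ?I"
    proof (rule I.I_r_closed)
      show "xpow w \<in> ?I" using genideal_self[OF gens] wu by blast
      show "Poly_Mapping.single u c \<in> carrier (poly_ring m)"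
        using wu by (simp add: carrier_poly_ring)
    qed
    then show ?thesis by (simp add: wu poly_ring_def xpow_def mult_single)
  qed
  show "?J \<subseteq> ?I"
  proof
    fix p :: "'k mpol" assume p: "p \<in> ?J"
    \<comment> \<open>The index set varies while the coefficients stay those of \<open>p\<close>, so
      that the induction runs over partial sums.\<close>
    have "(\<Sum>t\<in>T. Poly_Mapping.single t (Poly_Mapping.lookup p t)) \<in> ?I"
      if "finite T" "T \<subseteq> multiples m A" for T
      using that
    proof (induction T rule: finite_induct)
      case empty
      then show ?case using I.zero_closed by (simp add: poly_ring_def)
    next
      case (insert t T)
      then show ?case
        using I.a_closed[OF single[of t "Poly_Mapping.lookup p t"]] by (simp add: poly_ring_def)
    qed
    from this[of "Poly_Mapping.keys p"] p show "p \<in> ?I"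
      by (simp add: monomial_span_def flip: poly_mapping_eq_sum_single)
  qed
qed

section \<open>Evaluation of the last variables at zero\<close>

lemma xpow_zero: "xpow 0 = 1"
  by (simp add: xpow_def)

lemma xpow_add: "xpow (s + t) = xpow s * xpow t"
  by (simp add: xpow_def mult_single)

lemma xpow_eq_prod: "(xpow t :: ('k::field) mpol) =
    (\<Prod>i\<in>Poly_Mapping.keys t. xpow (Poly_Mapping.single i 1) ^ Poly_Mapping.lookup t i)"
proof -
  have pow: "(xpow (Poly_Mapping.single i 1) :: 'k mpol) ^ c = xpow (Poly_Mapping.single i c)" for i c
    by (induction c) (simp_all add: xpow_zero flip: xpow_add single_add)
  have prod: "(\<Prod>i\<in>T. xpow (f i) :: 'k mpol) = xpow (\<Sum>i\<in>T. f i)" if "finite T"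
    for T and f :: "nat \<Rightarrow> expo"
    using that by (induction T) (simp_all add: xpow_zero xpow_add)
  show ?thesis
    unfolding pow prod[OF finite_keys] poly_mapping_eq_sum_single[symmetric] ..
qed

text \<open>Every term involving a variable beyond the \<open>m\<close>th acquires a zero factor,
  and every other term is reproduced unchanged.\<close>

lemma eval_tail_zero_eq:
  fixes p :: "('k::field) mpol"
  assumes "p \<in> carrier (poly_ring n)"
  shows "eval_tail_zero m p =
    (\<Sum>t\<in>Poly_Mapping.keys p \<inter> expos m. Poly_Mapping.single t (Poly_Mapping.lookup p t))"
proof -
  let ?g = "\<lambda>t. Poly_Mapping.single 0 (Poly_Mapping.lookup p t) *
        (\<Prod>i\<in>Poly_Mapping.keys t.
           (if i \<le> m then xpow (Poly_Mapping.single i 1) else 0) ^ Poly_Mapping.lookup t i)"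
  have "?g t = (if t \<in> expos m then Poly_Mapping.single t (Poly_Mapping.lookup p t) else 0)"
    if t: "t \<in> Poly_Mapping.keys p" for t
  proof -
    \<comment> \<open>The evaluation keeps every index \<open>i \<le> m\<close>, including 0,
      whereas \<open>expos m\<close> starts at 1. The carrier excludes index 0, so the two
      conditions agree.\<close>
    have tn: "Poly_Mapping.keys t \<subseteq> {1..n}"
      using assms t by (auto simp: carrier_poly_ring expos_def)
    show ?thesis
    proof (cases "t \<in> expos m")
      case True
      then have "(\<Prod>i\<in>Poly_Mapping.keys t.
           (if i \<le> m then xpow (Poly_Mapping.single i 1) else 0) ^ Poly_Mapping.lookup t i)
         = (xpow t :: 'k mpol)"
        unfolding xpow_eq_prod[of t] by (intro prod.cong) (auto simp: expos_def)
      then show ?thesis using True by (simp add: xpow_def mult_single)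
    next
      case False
      then obtain i where i: "i \<in> Poly_Mapping.keys t" "\<not> i \<le> m"
        using tn by (fastforce simp: expos_def)
      then have "(\<Prod>i\<in>Poly_Mapping.keys t.
           (if i \<le> m then xpow (Poly_Mapping.single i 1) else 0) ^ Poly_Mapping.lookup t i)
         = (0 :: 'k mpol)"
        \<comment> \<open>The exponent of the \<open>i\<close>th variable is nonzero because
          \<open>i\<close> is a key, so this factor is 0 and not \<open>0 ^ 0 = 1\<close>.\<close>
        by (intro prod_zero) (auto simp: in_keys_iff intro!: bexI[of _ i])
      then show ?thesis using False by simp
    qed
  qed
  then have "eval_tail_zero m p = (\<Sum>t\<in>Poly_Mapping.keys p.
      if t \<in> expos m then Poly_Mapping.single t (Poly_Mapping.lookup p t) else 0)"
    unfolding eval_tail_zero_def by (intro sum.cong) auto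
  also have "\<dots> = (\<Sum>t\<in>Poly_Mapping.keys p \<inter> expos m. Poly_Mapping.single t (Poly_Mapping.lookup p t))"
    by (subst sum.inter_restrict) simp_all
  finally show ?thesis .
qed

text \<open>A surviving exponent \<open>w + u\<close> has \<open>w\<close> in
  \<open>expos m\<close>, so only generators in the first \<open>m\<close> variables contribute.
  Conversely, polynomials on the right already lie in the larger ideal and are fixed by the
  evaluation.\<close>

lemma eval_tail_zero_monomial_span:
  assumes "A \<subseteq> expos n" "m \<le> n"
  shows "eval_tail_zero m ` (monomial_span (multiples n A) :: ('k::field) mpol set)
    = monomial_span (multiples m (A \<inter> expos m))"
    (is "_ ` ?M = ?N")
proof (intro equalityI subsetI)
  have car: "p \<in> carrier (poly_ring n)" if "p \<in> ?M" for p
    using that multiples_subset_expos[OF assms(1)] by (auto simp: monomial_span_def carrier_poly_ring)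
  fix q :: "'k mpol"
  {
    assume "q \<in> eval_tail_zero m ` ?M"
    then obtain p where p: "p \<in> ?M" "q = eval_tail_zero m p" by blast
    have "t \<in> multiples m (A \<inter> expos m)" if "t \<in> Poly_Mapping.keys p" "t \<in> expos m" for t
      using that p(1) by (fastforce simp: monomial_span_def multiples_def add_mem_expos_iff)
    then have "Poly_Mapping.keys q \<subseteq> multiples m (A \<inter> expos m)"
      unfolding p(2) eval_tail_zero_eq[OF car[OF p(1)]]
      by (intro order.trans[OF keys_sum]) auto
    then show "q \<in> ?N" by (simp add: monomial_span_def)
  next
    assume q: "q \<in> ?N"
    have "multiples m (A \<inter> expos m) \<subseteq> multiples n A"
      using expos_mono[OF assms(2)] by (fastforce simp: multiples_def)
    then have qM: "q \<in> ?M" using q by (auto simp: monomial_span_def)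
    have "Poly_Mapping.keys q \<inter> expos m = Poly_Mapping.keys q"
      using q multiples_subset_expos[of "A \<inter> expos m" m] by (auto simp: monomial_span_def)
    then have "eval_tail_zero m q = q"
      by (simp add: eval_tail_zero_eq[OF car[OF qM]] flip: poly_mapping_eq_sum_single)
    then show "q \<in> eval_tail_zero m ` ?M" using qM by force
  }
qed

text \<open>The order compares degrees first, so a polynomial with leading exponent \<open>0\<close> is a constant.\<close>

lemma ideal_eq_carrier_if_lead_expo_0:
  fixes I :: "('k::field) mpol set"
  assumes "ideal I (poly_ring n)" "f \<in> I" "is_lead_expo f 0"
  shows "I = carrier (poly_ring n)"
proof -
  interpret ideal I "poly_ring n" by fact
  let ?c = "Poly_Mapping.lookup f 0"
  have "\<not> drl_less s 0" for s
    by (auto simp: drl_less_def expo_deg_def in_keys_iff)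
  then have keys: "Poly_Mapping.keys f = {0}"
    using assms(3) by (auto simp: is_lead_expo_def)
  then have c: "?c \<noteq> 0" by (metis in_keys_iff insertI1)
  have f: "f = Poly_Mapping.single 0 ?c"
    using poly_mapping_eq_sum_single[of f] keys by simp
  have "f \<otimes>\<^bsub>poly_ring n\<^esub> Poly_Mapping.single 0 (inverse ?c) \<in> I"
    by (rule I_r_closed[OF assms(2)]) (simp add: carrier_poly_ring)
  also have "f \<otimes>\<^bsub>poly_ring n\<^esub> Poly_Mapping.single 0 (inverse ?c) = \<one>\<^bsub>poly_ring n\<^esub>"
    by (subst f) (simp add: poly_ring_def mult_single c)
  finally show ?thesis by (rule one_imp_carrier)
qed

section \<open>The initial ideal and the graded components of a monomial quotient\<close>

lemma initial_ideal_eq: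
  fixes I :: "('k::field) mpol set"
  assumes "I \<subseteq> carrier (poly_ring n)"
  shows "initial_ideal n I = monomial_span (multiples n {t. \<exists>f\<in>I. is_lead_expo f t})"
proof -
  have "{t. \<exists>f\<in>I. is_lead_expo f t} \<subseteq> expos n"
    using assms by (auto simp: carrier_poly_ring is_lead_expo_def)
  from genideal_xpow[OF this] show ?thesis
    unfolding initial_ideal_def by (simp add: image_Collect)
qed

text \<open>A homogeneous polynomial outside \<open>J\<close> has a standard exponent among its
  keys, necessarily of degree \<open>r\<close>; conversely, a standard exponent gives a monomial
  outside \<open>J\<close>.\<close>

lemma quot_component_monomial_span:
  fixes J :: "('k::field) mpol set"
  assumes A: "A \<subseteq> expos m" and J: "J = monomial_span (multiples m A)"
  shows "quot_component m J r \<noteq> {\<zero>\<^bsub>poly_ring m Quot J\<^esub>} \<longleftrightarrow>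
    (\<exists>a\<in>expos m - multiples m A. expo_deg a = r)"
proof -
  interpret ideal J "poly_ring m" unfolding J by (rule ideal_monomial_span[OF A])
  have zero: "\<zero>\<^bsub>poly_ring m Quot J\<^esub> = J" by (simp add: FactRing_def)
  have coset: "J +>\<^bsub>poly_ring m\<^esub> f = J \<longleftrightarrow> f \<in> J" if "f \<in> carrier (poly_ring m)" for f
    using that a_coset_join1[OF _ _ a_subgroup] a_coset_join2[OF _ a_subgroup] by blast
  define H where "H = {f \<in> carrier (poly_ring m). homogeneous r (f :: 'k mpol)}"
  have "quot_component m J r = (\<lambda>f. J +>\<^bsub>poly_ring m\<^esub> f) ` H"
    by (auto simp: quot_component_def H_def)
  \<comment> \<open>The zero polynomial is homogeneous of every degree, so the component is never
    empty and differs from the zero component only by containing a nonzero coset.\<close>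
  moreover have "\<zero>\<^bsub>poly_ring m\<^esub> \<in> H"
    by (simp add: H_def poly_ring_def homogeneous_def)
  ultimately have "quot_component m J r \<noteq> {J} \<longleftrightarrow> (\<exists>f\<in>H. J +>\<^bsub>poly_ring m\<^esub> f \<noteq> J)"
    by auto
  also have "\<dots> \<longleftrightarrow> (\<exists>f\<in>carrier (poly_ring m). homogeneous r f \<and> f \<notin> J)"
    using coset by (auto simp: H_def)
  also have "\<dots> \<longleftrightarrow> (\<exists>a\<in>expos m - multiples m A. expo_deg a = r)"
  proof
    assume "\<exists>f\<in>carrier (poly_ring m). homogeneous r f \<and> f \<notin> J"
    then show "\<exists>a\<in>expos m - multiples m A. expo_deg a = r"
      by (fastforce simp: J monomial_span_def carrier_poly_ring homogeneous_def)
  next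
    assume "\<exists>a\<in>expos m - multiples m A. expo_deg a = r"
    then obtain a where "a \<in> expos m" "a \<notin> multiples m A" "expo_deg a = r" by blast
    then show "\<exists>f\<in>carrier (poly_ring m). homogeneous r f \<and> f \<notin> J"
      by (intro bexI[of _ "xpow a"] conjI xpow_carrier)
        (simp_all add: J, simp add: homogeneous_def xpow_def)
  qed
  finally show ?thesis by (simp add: zero)
qed

section \<open>Maximal standard exponents\<close>

lemma F_set_subset_standard:
  assumes "E \<subseteq> expos m"
  shows "F_set m E \<subseteq> expos m - multiples m E"
  using mem_multiples_iff[OF assms] by (fastforce simp: F_set_def)

lemma maximal_standard_in_F_set:
  assumes E: "E \<subseteq> expos m" and a: "a \<in> expos m - multiples m E"
    and max: "\<And>j. j \<in> {1..m} \<Longrightarrow> a + Poly_Mapping.single j 1 \<in> multiples m E"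
  shows "a \<in> F_set m E"
proof -
  have std: "\<not> (\<forall>j\<in>{1..m}. Poly_Mapping.lookup w j \<le> Poly_Mapping.lookup a j)" if "w \<in> E" for w
    using a that mem_multiples_iff[OF E, of a] by blast
  have "\<exists>w\<in>E. Poly_Mapping.lookup w j = Poly_Mapping.lookup a j + 1 \<and>
      (\<forall>h\<in>{1..m}. h \<noteq> j \<longrightarrow> Poly_Mapping.lookup w h \<le> Poly_Mapping.lookup a h)"
    if j: "j \<in> {1..m}" for j
  proof -
    have "a + Poly_Mapping.single j 1 \<in> expos m"
      using a single_expos[OF j] by (simp add: expos_add)
    then obtain w where w: "w \<in> E" "\<And>h. h \<in> {1..m} \<Longrightarrow>
        Poly_Mapping.lookup w h \<le> Poly_Mapping.lookup (a + Poly_Mapping.single j 1) h"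
      using max[OF j] mem_multiples_iff[OF E] by blast
    have other: "Poly_Mapping.lookup w h \<le> Poly_Mapping.lookup a h" if "h \<in> {1..m}" "h \<noteq> j" for h
      using w(2)[OF that(1)] that(2) by (simp add: lookup_add lookup_single)
    \<comment> \<open>As \<open>a\<close> is standard, \<open>w\<close> exceeds it somewhere, and
      \<open>j\<close> is the only place left. Together with the bound from
      \<open>a + Poly_Mapping.single j 1\<close>, the excess is exactly one.\<close>
    then have "\<not> Poly_Mapping.lookup w j \<le> Poly_Mapping.lookup a j"
      using std[OF w(1)] by metis
    moreover have "Poly_Mapping.lookup w j \<le> Poly_Mapping.lookup a j + 1"
      using w(2)[OF j] by (simp add: lookup_add)
    ultimately show ?thesis using other w(1) by (intro bexI[of _ w]) auto
  qed
  then obtain v where v: "\<And>j. j \<in> {1..m} \<Longrightarrow> v j \<in> E"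
    "\<And>j. j \<in> {1..m} \<Longrightarrow> Poly_Mapping.lookup (v j) j = Poly_Mapping.lookup a j + 1"
    "\<And>j h. j \<in> {1..m} \<Longrightarrow> h \<in> {1..m} \<Longrightarrow> h \<noteq> j \<Longrightarrow>
      Poly_Mapping.lookup (v j) h \<le> Poly_Mapping.lookup a h"
    by metis
  have less: "Poly_Mapping.lookup (v h) j < Poly_Mapping.lookup (v j) j"
    if "j \<in> {1..m}" "h \<in> {1..m}" "h \<noteq> j" for j h
    using v(2)[OF that(1)] v(3)[of h j] that by auto
  \<comment> \<open>The maximum is attained at \<open>h = j\<close>, since the other members of the
    family stay at or below \<open>a\<close> in coordinate \<open>j\<close>.\<close>
  have "Max ((\<lambda>h. Poly_Mapping.lookup (v h) j) ` {1..m}) = Poly_Mapping.lookup a j + 1"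
    if j: "j \<in> {1..m}" for j
  proof (rule Max_eqI)
    show "y \<le> Poly_Mapping.lookup a j + 1"
      if y: "y \<in> (\<lambda>h. Poly_Mapping.lookup (v h) j) ` {1..m}" for y
    proof -
      obtain h where h: "h \<in> {1..m}" "y = Poly_Mapping.lookup (v h) j" using y by blast
      then show ?thesis using v(2)[OF j] less[OF j h(1)] by (cases "h = j") auto
    qed
    show "Poly_Mapping.lookup a j + 1 \<in> (\<lambda>h. Poly_Mapping.lookup (v h) j) ` {1..m}"
      using v(2)[OF j] j by (metis imageI)
  qed simp
  then show ?thesis
    unfolding F_set_def using a v(1) less std
    by (intro CollectI conjI exI[of _ v] ballI) auto
qed

lemma F_set_max_degree:
  assumes E: "E \<subseteq> expos m" and "0 \<notin> E"
    and bounded: "Sup ((\<lambda>a. enat (expo_deg a)) ` (expos m - multiples m E)) < \<infinity>" (is "?r < _")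
  shows "finite (F_set m E) \<and> F_set m E \<noteq> {} \<and> ?r = enat (Max (expo_deg ` F_set m E))"
proof -
  let ?S = "expos m - multiples m E"
  obtain N where N: "?r = enat N" using bounded by auto
  have le_N: "expo_deg a \<le> N" if "a \<in> ?S" for a
    using that N by (metis (no_types, lifting) SUP_upper enat_ord_simps(1))
  have finS: "finite ?S"
    by (rule finite_subset[OF _ finite_expos_deg_le[of m N]]) (use le_N in auto)
  \<comment> \<open>This provides a standard exponent. With none, the supremum in
    \<open>enat\<close> would be 0 although \<open>F_set m E\<close> would be empty.\<close>
  have "0 \<in> ?S" using \<open>0 \<notin> E\<close> by (simp add: zero_mem_multiples_iff)
  then obtain a where a: "a \<in> ?S" "\<And>b. b \<in> ?S \<Longrightarrow> expo_deg b \<le> expo_deg a"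
    using obtains_MAX[OF finS, of expo_deg] finS by (metis Max_ge empty_iff finite_imageI imageI)
  have r: "?r = enat (expo_deg a)"
    by (intro antisym SUP_least SUP_upper2[OF a(1)]) (use a(2) in auto)
  have aF: "a \<in> F_set m E"
  proof (rule maximal_standard_in_F_set[OF E a(1)])
    fix j assume j: "j \<in> {1..m}"
    show "a + Poly_Mapping.single j 1 \<in> multiples m E"
    proof (rule ccontr)
      assume "a + Poly_Mapping.single j 1 \<notin> multiples m E"
      then have "expo_deg (a + Poly_Mapping.single j 1) \<le> expo_deg a"
        using a(1) single_expos[OF j] by (intro a(2)) (simp add: expos_add)
      then show False
        using a(1) single_expos[OF j] by (simp add: expo_deg_add[of _ m])
    qed
  qed
  have finF: "finite (F_set m E)"
    using finite_subset[OF F_set_subset_standard[OF E] finS] .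
  \<comment> \<open>All of \<open>F_set m E\<close> is standard, so no element exceeds the degree of
    \<open>a\<close>, which itself belongs to the set.\<close>
  moreover have "Max (expo_deg ` F_set m E) = expo_deg a"
    by (rule Max_eqI) (use aF finF a(2) F_set_subset_standard[OF E] in auto)
  ultimately show ?thesis using aF r by auto
qed

theorem proposition4p3:
  fixes n d :: nat
    and I B :: "('k::field) mpol set"
  assumes "n \<ge> 1"
    and "homogeneous_ideal n I"
    and "I \<noteq> carrier (poly_ring n)"
    and "krull_dim (poly_ring n Quot I) = enat d"
    and "minimal_monomial_generators n (initial_ideal n I) B"
    and "r_inv n d I < \<infinity>"
  shows "finite (F_set (n - d) (E_set (n - d) B)) \<and> F_set (n - d) (E_set (n - d) B) \<noteq> {} \<and>
    r_inv n d I = enat (Max (expo_deg ` F_set (n - d) (E_set (n - d) B)))"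
proof -
  define m where "m = n - d"
  define A where "A = {v \<in> expos n. xpow v \<in> B}"
  have ideal: "ideal I (poly_ring n)"
    using assms(2) by (simp add: homogeneous_ideal_def)
  have AB: "A \<subseteq> expos n" "xpow ` A = B"
    using assms(5) by (auto simp: A_def minimal_monomial_generators_def)
  have m: "m \<le> n" by (simp add: m_def)
  have E: "E_set m B = A \<inter> expos m"
    using expos_mono[OF m] by (auto simp: E_set_def A_def)
  have init: "initial_ideal n I = monomial_span (multiples n A)"
    using assms(5) genideal_xpow[OF AB(1), where ?'k = 'k] AB(2)
    by (simp add: minimal_monomial_generators_def)
  have J: "J_ideal n d I = monomial_span (multiples m (E_set m B))"
    unfolding J_ideal_def init E m_def[symmetric] by (rule eval_tail_zero_monomial_span[OF AB(1) m])
  \<comment> \<open>Two descriptions of the initial ideal are compared at exponent 0: one by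
    \<open>A\<close>, one by leading exponents. Since 0 is a multiple only of itself, some
    \<open>f\<close> in \<open>I\<close> would have leading exponent 0, which forces
    \<open>I\<close> to be the whole ring.\<close>
  have "0 \<notin> A"
  proof
    assume "0 \<in> A"
    then have "xpow 0 \<in> initial_ideal n I" by (simp add: init zero_mem_multiples_iff)
    then obtain f where "f \<in> I" "is_lead_expo f 0"
      using initial_ideal_eq[of I n] additive_subgroup.a_subset[OF ideal.axioms(1)[OF ideal]]
      by (auto simp: zero_mem_multiples_iff)
    then show False using ideal_eq_carrier_if_lead_expo_0[OF ideal] assms(3) by blast
  qed
  then have E': "E_set m B \<subseteq> expos m" "0 \<notin> E_set m B" by (auto simp: E)
  have "r_inv n d I = Sup ((\<lambda>a. enat (expo_deg a)) ` (expos m - multiples m (E_set m B)))"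
    unfolding r_inv_def m_def[symmetric] quot_component_monomial_span[OF E'(1) J]
    by (rule arg_cong[of _ _ Sup]) auto
  then show ?thesis
    using F_set_max_degree[OF E'] assms(6) unfolding m_def[symmetric] by simp
qed

end
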